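(* Let $\alpha\in\mathbb{R}$ and let $N$ be a complex $n\times n$ matrix with $N^2=0$ and $\overline{N}=N$, such that $$N'=\left(\mathrm{Id}-\tfrac{1}{2\alpha}N\right)\left(\mathrm{Id}+\tfrac{1}{4\alpha^2}N^tN\right)^{-1}N^t\left(\mathrm{Id}+\tfrac{1}{2\alpha}N\right)$$ is well-defined (so in particular $\alpha\ne0$). Then $s_{\alpha,N}:=m_{-\alpha,1,N'}\,m_{\alpha,1,N}$ belongs to $\mathcal{L}_-^{\tau,\sigma}(\mathrm{GL}(n,\mathbb{C}))$.
   Context: For $\gamma\in\mathbb{C}$ and a matrix $P$, $m_{\gamma,1,P}(\lambda)=\mathrm{Id}+\frac{1}{\lambda-\gamma}P$. $\mathcal{L}_-^{\tau,\sigma}(\mathrm{GL}(n,\mathbb{C}))$ denotes the group of meromorphic maps $g:\mathbb{CP}^1\to\mathrm{GL}(n,\mathbb{C})$ (matrices of rational functions, invertible away from finitely many points) with $g(\infty)=\mathrm{Id}$ that satisfy the reality condition $\tau(g(\lambda))=g(\bar\lambda)$ and the twisting condition $\sigma(g(-\lambda))=g(\lambda)$, where on the group $\tau(A)=\overline{A}$ and $\sigma(A)=(A^t)^{-1}$ (on the Lie algebra, $\sigma$ is $A\mapsto -A^t$). *)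

theory Defs
  imports
    "HOL-Analysis.Analysis"
    "HOL-Computational_Algebra.Polynomial"
    "HOL-Computational_Algebra.Fraction_Field"
begin

text \<open>
  Meromorphic functions on the Riemann sphere are the elements of the field
  \<open>complex poly fract\<close> of rational functions in the variable \<open>\<lambda>\<close>. Products of matrices over
  this field are products of meromorphic maps, without any convention about values at poles.
\<close>

type_synonym rat_fun = "complex poly fract"

definition rf_const :: "complex \<Rightarrow> rat_fun" where
  "rf_const c = Fraction_Field.Fract [:c:] 1"

definition rf_var :: rat_fun where
  "rf_var = Fraction_Field.Fract [:0, 1:] 1"

text \<open>
  \<open>rf_has_value r z w\<close>: the rational function \<open>r\<close> is holomorphic at the finite point \<open>z\<close> with value
  \<open>w\<close>. It holds for no \<open>w\<close> when \<open>z\<close> is a pole, because in every representation \<open>p / q\<close> of \<open>r\<close>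
  the denominator then vanishes at \<open>z\<close>; the value is unique otherwise.
\<close>

definition rf_has_value :: "rat_fun \<Rightarrow> complex \<Rightarrow> complex \<Rightarrow> bool" where
  "rf_has_value r z w \<longleftrightarrow>
     (\<exists>p q. r = Fraction_Field.Fract p q \<and> poly q z \<noteq> 0 \<and> w = poly p z / poly q z)"

definition rf_has_value_at_infinity :: "rat_fun \<Rightarrow> complex \<Rightarrow> bool" where
  "rf_has_value_at_infinity r w \<longleftrightarrow>
     (\<exists>p q. r = Fraction_Field.Fract p q \<and> q \<noteq> 0 \<and>
        ((\<lambda>z. poly p z / poly q z) \<longlongrightarrow> w) at_infinity)"

lemma rf_has_value_unique:
  assumes "rf_has_value r z v" "rf_has_value r z w"
  shows "v = w"
proof -
  obtain p q where 1: "r = Fraction_Field.Fract p q" "poly q z \<noteq> 0" "v = poly p z / poly q z"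
    using assms(1) unfolding rf_has_value_def by blast
  obtain p' q' where 2: "r = Fraction_Field.Fract p' q'" "poly q' z \<noteq> 0" "w = poly p' z / poly q' z"
    using assms(2) unfolding rf_has_value_def by blast
  have "q \<noteq> 0" "q' \<noteq> 0" using 1 2 by auto
  then have "p * q' = p' * q" using 1(1) 2(1) by (simp add: Fraction_Field.eq_fract)
  then have "poly p z * poly q' z = poly p' z * poly q z" by (metis poly_mult)
  then show ?thesis using 1 2 by (simp add: frac_eq_eq)
qed

text \<open>
  \<open>takes_GL_value g z A\<close>: at the finite point \<open>z\<close> the meromorphic map \<open>g\<close> is holomorphic, and its
  value \<open>A\<close> lies in \<open>GL(n,\<complex>)\<close>.
\<close>

definition takes_GL_value :: "rat_fun ^'n^'n \<Rightarrow> complex \<Rightarrow> complex ^'n^'n \<Rightarrow> bool" where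
  "takes_GL_value g z A \<longleftrightarrow> (\<forall>i j. rf_has_value (g $ i $ j) z (A $ i $ j)) \<and> invertible A"

definition tau_GL :: "complex ^'n^'n \<Rightarrow> complex ^'n^'n" where
  "tau_GL A = map_matrix cnj A"

definition sigma_GL :: "complex ^'n^'n \<Rightarrow> complex ^'n^'n" where
  "sigma_GL A = matrix_inv (transpose A)"

text \<open>
  The reality and twisting conditions are imposed at the finite points where the map is
  \<open>GL(n,\<complex>)\<close>-valued, that is, at all but finitely many points (at infinity they hold trivially,
  the value being the identity).
\<close>

definition L_minus_tau_sigma :: "(rat_fun ^'n^'n) set" where
  "L_minus_tau_sigma = {g.
     finite {z. \<not> (\<exists>A. takes_GL_value g z A)} \<and>
     (\<forall>i j. rf_has_value_at_infinity (g $ i $ j) (mat 1 $ i $ j)) \<and>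
     (\<forall>z A. takes_GL_value g z A \<longrightarrow> takes_GL_value g (cnj z) (tau_GL A)) \<and>
     (\<forall>z A. takes_GL_value g (- z) A \<longrightarrow> takes_GL_value g z (sigma_GL A))}"

definition m_simple :: "complex \<Rightarrow> complex ^'n^'n \<Rightarrow> rat_fun ^'n^'n" where
  "m_simple \<gamma> P = mat 1 + (\<chi> i j. 1 / (rf_var - rf_const \<gamma>) * rf_const (P $ i $ j))"

lemma takes_GL_value_m_simple:
  fixes P :: "complex ^'n^'n"
  assumes "z \<noteq> \<gamma>" "invertible (mat 1 + (\<chi> i j. 1 / (z - \<gamma>) * P $ i $ j) :: complex ^'n^'n)"
  shows "takes_GL_value (m_simple \<gamma> P) z (mat 1 + (\<chi> i j. 1 / (z - \<gamma>) * P $ i $ j))"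
proof -
  have "rf_has_value (m_simple \<gamma> P $ i $ j) z
          ((mat 1 + (\<chi> i j. 1 / (z - \<gamma>) * P $ i $ j) :: complex ^'n^'n) $ i $ j)" for i j
  proof -
    have "m_simple \<gamma> P $ i $ j =
        Fraction_Field.Fract ((if i = j then [:- \<gamma>, 1:] else 0) + [:P $ i $ j:]) [:- \<gamma>, 1:]"
      by (simp add: m_simple_def mat_def rf_var_def rf_const_def Fraction_Field.One_fract_def
          Fraction_Field.Zero_fract_def Fraction_Field.eq_fract)
    moreover have "poly [:- \<gamma>, 1:] z \<noteq> 0" using assms(1) by simp
    moreover have "(mat 1 + (\<chi> i j. 1 / (z - \<gamma>) * P $ i $ j) :: complex ^'n^'n) $ i $ j =
        poly ((if i = j then [:- \<gamma>, 1:] else 0) + [:P $ i $ j:]) z / poly [:- \<gamma>, 1:] z"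
      using assms(1) by (simp add: mat_def field_simps)
    ultimately show ?thesis unfolding rf_has_value_def by blast
  qed
  then show ?thesis using assms(2) by (simp add: takes_GL_value_def)
qed

definition N_prime :: "real \<Rightarrow> complex ^'n^'n \<Rightarrow> complex ^'n^'n" where
  "N_prime \<alpha> N =
     (mat 1 - (1 / (2 * \<alpha>)) *\<^sub>R N)
     ** matrix_inv (mat 1 + (1 / (4 * \<alpha>\<^sup>2)) *\<^sub>R (transpose N ** N))
     ** transpose N
     ** (mat 1 + (1 / (2 * \<alpha>)) *\<^sub>R N)"

definition s_elem :: "real \<Rightarrow> complex ^'n^'n \<Rightarrow> rat_fun ^'n^'n" where
  "s_elem \<alpha> N = m_simple (- complex_of_real \<alpha>) (N_prime \<alpha> N) ** m_simple (complex_of_real \<alpha>) N"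

end

theory Submission
  imports Defs
begin

text \<open>
  Put \<open>n = N / (2 \<alpha>)\<close>, \<open>m = n\<^sup>t\<close>, \<open>n' = N' / (2 \<alpha>)\<close> and \<open>K = (1 + m n)\<^sup>-\<^sup>1\<close>. Since \<open>n\<^sup>2 = m\<^sup>2 = 0\<close>, we
  have \<open>K n = n\<close> and \<open>m K = m\<close>, and \<open>n' = (1 - n) K m (1 + n)\<close> is conjugate to \<open>K m\<close>; hence
  \<open>n'\<^sup>2 = 0\<close> and \<open>(1 + n'\<^sup>t) n' = m (1 + n)\<close>. With \<open>x = 2 \<alpha> / (\<lambda> - \<alpha>)\<close> and \<open>y = 2 \<alpha> / (\<lambda> + \<alpha>)\<close> the map is
  \<open>s(\<lambda>) = (1 + y n') (1 + x n)\<close>, and \<open>x y = x - y\<close>. The last identity for \<open>n'\<close> and its transpose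
  then say that \<open>(1 - x n'\<^sup>t) (1 + y n') = (1 + y m) (1 - x n)\<close>, which by nilpotency is the twisting
  condition \<open>s(-\<lambda>)\<^sup>t s(\<lambda>) = 1\<close>.

  The conditions must also be checked at \<open>\<lambda> = \<plusminus>\<alpha>\<close> in case \<open>s\<close> is regular there. But the residues of
  \<open>s\<close> at these points are \<open>N\<close> and \<open>N'\<close> times invertible matrices, so regularity at either of them
  forces \<open>N = 0\<close> and \<open>s = 1\<close>.
\<close>

subsection \<open>Matrices over commutative rings and fields\<close>

lemma matrix_diff_ldistrib:
  fixes A :: "'a::ring_1^'n^'m"
  shows "A ** (B - C) = A ** B - A ** C"
  by (simp add: vec_eq_iff matrix_matrix_mult_def sum_subtractf right_diff_distrib)

lemma matrix_diff_rdistrib: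
  fixes A B :: "'a::ring_1^'n^'m"
  shows "(A - B) ** C = A ** C - B ** C"
  by (simp add: vec_eq_iff matrix_matrix_mult_def sum_subtractf left_diff_distrib)

lemma matrix_plus_rdistrib:
  fixes A B :: "'a::ring_1^'n^'m"
  shows "(A + B) ** C = A ** C + B ** C"
  by (simp add: vec_eq_iff matrix_matrix_mult_def sum.distrib distrib_right)

lemmas matrix_distribs =
  matrix_add_ldistrib matrix_plus_rdistrib matrix_diff_ldistrib matrix_diff_rdistrib

lemma transpose_add: "transpose (A + B) = transpose A + transpose B"
  by (simp add: transpose_def vec_eq_iff)

lemma transpose_diff: "transpose (A - B) = transpose A - transpose B"
  by (simp add: transpose_def vec_eq_iff)

text \<open>Over a field a one-sided inverse of a square matrix is two-sided. This reduces the
  twisting condition to a single matrix equation.\<close>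

lemma matrix_inv_eqI:
  fixes A B :: "'a::field^'n^'n"
  assumes "A ** B = mat 1"
  shows "matrix_inv A = B"
proof -
  have "invertible A"
    using assms invertible_right_inverse by blast
  then have "matrix_inv A ** A = mat 1"
    unfolding invertible_def matrix_inv_def by (metis (mono_tags, lifting) someI_ex)
  then show ?thesis
    by (metis assms matrix_mul_assoc matrix_mul_lid matrix_mul_rid)
qed

lemma matrix_inv_right:
  fixes A :: "'a::field^'n^'n"
  assumes "invertible A"
  shows "A ** matrix_inv A = mat 1"
  using assms matrix_inv_eqI unfolding invertible_def by metis

lemma transpose_matrix_inv:
  fixes A :: "'a::field^'n^'n"
  assumes "invertible A"
  shows "transpose (matrix_inv A) = matrix_inv (transpose A)"
proof -
  have "matrix_inv A ** A = mat 1"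
    using matrix_inv_right[OF assms] matrix_left_right_inverse by blast
  then have "transpose A ** transpose (matrix_inv A) = mat 1"
    by (metis matrix_transpose_mul transpose_mat)
  then show ?thesis
    by (simp add: matrix_inv_eqI)
qed

section \<open>Entrywise complex conjugation of matrices\<close>

lemma map_matrix_cnj_mult:
  "map_matrix cnj (A ** B) = map_matrix cnj A ** map_matrix cnj B"
  by (simp add: vec_eq_iff matrix_matrix_mult_def)

lemma map_matrix_cnj_add:
  "map_matrix cnj (A + B) = map_matrix cnj A + map_matrix cnj B"
  by (simp add: vec_eq_iff)

lemma map_matrix_cnj_diff:
  "map_matrix cnj (A - B) = map_matrix cnj A - map_matrix cnj B"
  by (simp add: vec_eq_iff)

lemma map_matrix_cnj_mat_1: "map_matrix cnj (mat 1) = mat 1"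
  by (simp add: vec_eq_iff mat_def)

lemma map_matrix_cnj_scaleR: "map_matrix cnj (c *\<^sub>R A) = c *\<^sub>R map_matrix cnj A"
  by (simp add: vec_eq_iff)

lemma map_matrix_cnj_transpose: "map_matrix cnj (transpose A) = transpose (map_matrix cnj A)"
  by (simp add: vec_eq_iff transpose_def)

lemma map_matrix_cnj_matrix_inv:
  fixes A :: "complex^'n^'n"
  assumes "invertible A"
  shows "map_matrix cnj (matrix_inv A) = matrix_inv (map_matrix cnj A)"
  using matrix_inv_right[OF assms]
  by (metis map_matrix_cnj_mult map_matrix_cnj_mat_1 matrix_inv_eqI)

lemmas map_matrix_cnj = map_matrix_cnj_mult map_matrix_cnj_add map_matrix_cnj_diff
  map_matrix_cnj_mat_1 map_matrix_cnj_scaleR map_matrix_cnj_transpose map_matrix_cnj_matrix_inv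

text \<open>Unlike the real scalars of \<open>*\<^sub>R\<close>, the coefficients of the simple
  factors are complex numbers, and poles are cleared by scalars that are rational functions.\<close>

definition scale_matrix :: "'a::times \<Rightarrow> 'a^'n^'m \<Rightarrow> 'a^'n^'m" where
  "scale_matrix c A = (\<chi> i j. c * A $ i $ j)"

lemma scale_matrix_nth [simp]: "scale_matrix c A $ i $ j = c * A $ i $ j"
  by (simp add: scale_matrix_def)

lemma scale_matrix_mult_left:
  fixes A :: "'a::comm_semiring_1^'n^'m"
  shows "scale_matrix c A ** B = scale_matrix c (A ** B)"
  by (simp add: vec_eq_iff matrix_matrix_mult_def sum_distrib_left mult.assoc)

lemma scale_matrix_mult_right:
  fixes A :: "'a::comm_semiring_1^'n^'m"
  shows "A ** scale_matrix c B = scale_matrix c (A ** B)"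
  by (simp add: vec_eq_iff matrix_matrix_mult_def sum_distrib_left ac_simps)

lemma transpose_scale_matrix: "transpose (scale_matrix c A) = scale_matrix c (transpose A)"
  by (simp add: vec_eq_iff transpose_def)

text \<open>The mixed terms cancel and the remaining one is a multiple of
  \<open>A ** A\<close>.\<close>

lemma add_mult_diff_nilpotent:
  fixes A :: "'a::comm_ring_1^'n^'n"
  assumes "A ** A = 0"
  shows "(mat 1 + scale_matrix c A) ** (mat 1 - scale_matrix c A) = mat 1"
    and "(mat 1 - scale_matrix c A) ** (mat 1 + scale_matrix c A) = mat 1"
  using assms
  by (simp_all add: matrix_distribs scale_matrix_mult_left scale_matrix_mult_right vec_eq_iff)

lemma invertible_mat_1_add_nilpotent:
  fixes A :: "'a::comm_ring_1^'n^'n"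
  assumes "A ** A = 0"
  shows "invertible (mat 1 + scale_matrix c A)"
  unfolding invertible_def using add_mult_diff_nilpotent[OF assms] by blast

subsection \<open>The dressed nilpotent matrix\<close>

context
  fixes m n K :: "'a::ring_1^'n^'n"
  assumes nn: "n ** n = 0" and mm: "m ** m = 0"
    and Kl: "K ** (mat 1 + m ** n) = mat 1" and Kr: "(mat 1 + m ** n) ** K = mat 1"
begin

text \<open>Since n^2 = 0, left multiplication by 1 + m n fixes n, hence so does its inverse K. The
  next lemma is the mirror image.\<close>

lemma inverse_mult_nilpotent: "K ** n = n"
proof -
  have "n = K ** (mat 1 + m ** n) ** n"
    by (simp add: Kl)
  also have "\<dots> = K ** n + K ** m ** (n ** n)"
    by (simp add: matrix_distribs matrix_mul_assoc)
  finally show ?thesis by (simp add: nn)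
qed

lemma nilpotent_mult_inverse: "m ** K = m"
proof -
  have "m = m ** ((mat 1 + m ** n) ** K)"
    by (simp add: Kr)
  also have "\<dots> = m ** K + (m ** m) ** n ** K"
    by (simp add: matrix_distribs matrix_mul_assoc)
  finally show ?thesis by (simp add: mm)
qed

text \<open>The inner factors (1 + n) (1 - n) cancel, which leaves m K m = m m = 0 in the
  middle.\<close>

lemma dressed_nilpotent_square:
  "((mat 1 - n) ** K ** m ** (mat 1 + n)) ** ((mat 1 - n) ** K ** m ** (mat 1 + n)) = 0"
proof -
  have "(mat 1 + n) ** (mat 1 - n) = mat 1"
    by (simp add: matrix_distribs nn)
  moreover have "((mat 1 - n) ** K ** m ** (mat 1 + n)) ** ((mat 1 - n) ** K ** m ** (mat 1 + n))
    = (mat 1 - n) ** K ** m ** ((mat 1 + n) ** (mat 1 - n)) ** (K ** m ** (mat 1 + n))"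
    by (simp only: matrix_mul_assoc)
  moreover have "(mat 1 - n) ** K ** m ** mat 1 ** (K ** m ** (mat 1 + n))
    = (mat 1 - n) ** K ** (m ** K ** m) ** (mat 1 + n)"
    by (simp only: matrix_mul_assoc matrix_mul_rid)
  ultimately show ?thesis
    by (simp add: nilpotent_mult_inverse mm)
qed

text \<open>For m = n^t and symmetric K the left factor is 1 + n'^t. Writing it without transposes
  makes this an identity between words in m, n and K, valid over noncommutative rings.\<close>

lemma dressed_nilpotent_identity:
  "(mat 1 + (mat 1 + m) ** n ** K ** (mat 1 - m)) ** ((mat 1 - n) ** K ** m ** (mat 1 + n))
    = m ** (mat 1 + n)"
proof -
  have mnK: "m ** n ** K = mat 1 - K"
    using Kr by (simp add: matrix_distribs eq_diff_eq add.commute)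
  \<comment> \<open>Products are normalised to left-nested form, so each relation is also needed
    behind an arbitrary prefix X.\<close>
  have nn': "X ** n ** n = 0" and mm': "X ** m ** m = 0" and Kn': "X ** K ** n = X ** n"
    and mK': "X ** m ** K = X ** m" and mnK': "X ** m ** n ** K = X - X ** K"
    for X :: "'a^'n^'n"
    using matrix_mul_assoc[of X n n] matrix_mul_assoc[of X m m] matrix_mul_assoc[of X K n]
      matrix_mul_assoc[of X m K] matrix_mul_assoc[of X "m ** n" K] matrix_mul_assoc[of X m n]
    by (simp_all add: nn mm inverse_mult_nilpotent nilpotent_mult_inverse mnK matrix_diff_ldistrib)
  have "(mat 1 + (mat 1 + m) ** n ** K ** (mat 1 - m)) ** ((mat 1 - n) ** K ** m) = m"
    by (simp add: matrix_distribs matrix_mul_assoc nn mm nn' mm' mnK mnK' Kn' mK'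
        inverse_mult_nilpotent nilpotent_mult_inverse)
  then show ?thesis
    by (simp add: matrix_mul_assoc)
qed

end

text \<open>Replacing \<lambda> by -\<lambda> turns x into -y and y into -x, so the transposed
  product is s(-\<lambda>).\<close>

lemma dressed_factor_twisted:
  fixes n n' :: "'a::comm_ring_1^'n^'n"
  assumes nn: "n ** n = 0"
    and id: "(mat 1 + transpose n') ** n' = transpose n ** (mat 1 + n)"
    and xy: "x * y = x - y"
  shows "transpose ((mat 1 - scale_matrix x n') ** (mat 1 - scale_matrix y n))
    ** ((mat 1 + scale_matrix y n') ** (mat 1 + scale_matrix x n)) = mat 1"
proof -
  define m m' where "m = transpose n" and "m' = transpose n'"
  have mm: "m ** m = 0"
    unfolding m_def by (metis matrix_transpose_mul nn transpose_mat mat_0)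
  have t1: "n' + m' ** n' = m + m ** n"
    using id by (simp add: matrix_distribs m_def m'_def)
  \<comment> \<open>Both m' n' and m n are symmetric, so transposing \<open>t1\<close> changes only
    the linear terms.\<close>
  have "transpose (n' + m' ** n') = transpose (m + m ** n)"
    using t1 by simp
  then have t2: "m' + m' ** n' = n + m ** n"
    by (simp add: m_def m'_def transpose_add matrix_transpose_mul)
  have "(mat 1 - scale_matrix x m') ** (mat 1 + scale_matrix y n')
    = (mat 1 + scale_matrix y m) ** (mat 1 - scale_matrix x n)"
  proof -
    \<comment> \<open>Eliminate the linear terms n' and m' by \<open>t1\<close> and
      \<open>t2\<close>; once x y is replaced by x - y, all multiples of m' n' cancel.\<close>
    have "y * n' $ i $ j - x * m' $ i $ j - x * (y * (m' ** n') $ i $ j)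
      = y * m $ i $ j - x * n $ i $ j - x * (y * (m ** n) $ i $ j)" for i j
    proof -
      have e1: "n' $ i $ j = m $ i $ j + (m ** n) $ i $ j - (m' ** n') $ i $ j"
        using arg_cong[OF t1, of "\<lambda>A. A $ i $ j"] by (simp add: eq_diff_eq)
      have e2: "m' $ i $ j = n $ i $ j + (m ** n) $ i $ j - (m' ** n') $ i $ j"
        using arg_cong[OF t2, of "\<lambda>A. A $ i $ j"] by (simp add: eq_diff_eq)
      show ?thesis
        unfolding e1 e2 mult.assoc[symmetric] xy by (simp add: algebra_simps)
    qed
    then show ?thesis
      by (simp add: matrix_distribs scale_matrix_mult_left scale_matrix_mult_right vec_eq_iff
          algebra_simps)
  qed
  moreover have "transpose ((mat 1 - scale_matrix x n') ** (mat 1 - scale_matrix y n))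
    = (mat 1 - scale_matrix y m) ** (mat 1 - scale_matrix x m')"
    by (simp add: matrix_transpose_mul transpose_diff transpose_scale_matrix m_def m'_def)
  moreover have "(mat 1 - scale_matrix y m) ** (mat 1 - scale_matrix x m')
      ** ((mat 1 + scale_matrix y n') ** (mat 1 + scale_matrix x n))
    = (mat 1 - scale_matrix y m)
      ** ((mat 1 - scale_matrix x m') ** (mat 1 + scale_matrix y n'))
      ** (mat 1 + scale_matrix x n)"
    by (simp only: matrix_mul_assoc)
  ultimately have "transpose ((mat 1 - scale_matrix x n') ** (mat 1 - scale_matrix y n))
    ** ((mat 1 + scale_matrix y n') ** (mat 1 + scale_matrix x n))
    = ((mat 1 - scale_matrix y m) ** (mat 1 + scale_matrix y m))
      ** ((mat 1 - scale_matrix x n) ** (mat 1 + scale_matrix x n))"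
    by (simp only: matrix_mul_assoc)
  then show ?thesis
    by (simp add: add_mult_diff_nilpotent nn mm)
qed

subsection \<open>Values of rational functions\<close>

lemma rf_has_value_add:
  assumes "rf_has_value r z v" "rf_has_value s z w"
  shows "rf_has_value (r + s) z (v + w)"
proof -
  obtain p q where 1: "r = Fraction_Field.Fract p q" "poly q z \<noteq> 0" "v = poly p z / poly q z"
    using assms(1) unfolding rf_has_value_def by blast
  obtain p' q' where 2: "s = Fraction_Field.Fract p' q'" "poly q' z \<noteq> 0" "w = poly p' z / poly q' z"
    using assms(2) unfolding rf_has_value_def by blast
  have "q \<noteq> 0" "q' \<noteq> 0" using 1 2 by auto
  then have "r + s = Fraction_Field.Fract (p * q' + p' * q) (q * q')"
    using 1 2 by simp
  moreover have "v + w = poly (p * q' + p' * q) z / poly (q * q') z"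
    using 1 2 by (simp add: add_frac_eq)
  moreover have "poly (q * q') z \<noteq> 0" using 1 2 by simp
  ultimately show ?thesis unfolding rf_has_value_def by blast
qed

lemma rf_has_value_mult:
  assumes "rf_has_value r z v" "rf_has_value s z w"
  shows "rf_has_value (r * s) z (v * w)"
proof -
  obtain p q where 1: "r = Fraction_Field.Fract p q" "poly q z \<noteq> 0" "v = poly p z / poly q z"
    using assms(1) unfolding rf_has_value_def by blast
  obtain p' q' where 2: "s = Fraction_Field.Fract p' q'" "poly q' z \<noteq> 0" "w = poly p' z / poly q' z"
    using assms(2) unfolding rf_has_value_def by blast
  have "r * s = Fraction_Field.Fract (p * p') (q * q')" "poly (q * q') z \<noteq> 0"
    "v * w = poly (p * p') z / poly (q * q') z"
    using 1 2 by simp_all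
  then show ?thesis unfolding rf_has_value_def by blast
qed

lemma rf_has_value_const: "rf_has_value (rf_const c) z c"
  unfolding rf_has_value_def rf_const_def
  by (rule exI[of _ "[:c:]"], rule exI[of _ 1]) simp

lemma rf_const_0: "rf_const 0 = 0" and rf_const_1: "rf_const 1 = 1"
  by (simp_all add: rf_const_def Fraction_Field.Zero_fract_def Fraction_Field.One_fract_def
      one_pCons)

lemma rf_has_value_sum:
  assumes "\<And>k. k \<in> A \<Longrightarrow> rf_has_value (f k) z (v k)"
  shows "rf_has_value (sum f A) z (sum v A)"
  using assms
  \<comment> \<open>A sum over an infinite set is 0 by convention, so that case, like the empty one,
    asks for the value of the zero function.\<close>
  by (induction A rule: infinite_finite_induct)
    (auto simp: rf_has_value_add rf_has_value_const[of 0, unfolded rf_const_0])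

lemma rf_has_value_matrix_mult:
  assumes "\<And>i j. rf_has_value (g $ i $ j) z (A $ i $ j)"
    and "\<And>i j. rf_has_value (h $ i $ j) z (B $ i $ j)"
  shows "rf_has_value ((g ** h) $ i $ j) z ((A ** B) $ i $ j)"
  by (simp add: matrix_matrix_mult_def rf_has_value_sum rf_has_value_mult assms)

lemma takes_GL_value_mult:
  assumes "takes_GL_value g z A" "takes_GL_value h z B"
  shows "takes_GL_value (g ** h) z (A ** B)"
  using assms by (simp add: takes_GL_value_def rf_has_value_matrix_mult invertible_mult)

lemma takes_GL_value_unique:
  assumes "takes_GL_value g z A" "takes_GL_value g z B"
  shows "A = B"
  using assms unfolding takes_GL_value_def vec_eq_iff by (metis rf_has_value_unique)

lemma rf_has_value_mat_1: "rf_has_value (mat 1 $ i $ j) z (mat 1 $ i $ j)"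
  using rf_has_value_const[of 0 z] rf_has_value_const[of 1 z]
  by (simp add: mat_def rf_const_0 rf_const_1)

lemma takes_GL_value_mat_1:
  "takes_GL_value (mat 1 :: rat_fun^'n^'n) z (mat 1)"
proof -
  have "invertible (mat 1 :: complex^'n^'n)"
    unfolding invertible_def by (rule exI[of _ "mat 1"]) simp
  then show ?thesis
    by (simp add: takes_GL_value_def rf_has_value_mat_1)
qed

text \<open>The finitely many roots of q are bounded. Far out, fractions can thus be brought to a
  common denominator without meeting a division by 0.\<close>

lemma eventually_poly_nonzero_at_infinity:
  fixes q :: "complex poly"
  assumes "q \<noteq> 0"
  shows "eventually (\<lambda>z. poly q z \<noteq> 0) at_infinity"
proof -
  have "bounded {z. poly q z = 0}"
    using assms by (simp add: poly_roots_finite finite_imp_bounded)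
  then obtain B where "\<And>z. poly q z = 0 \<Longrightarrow> norm z \<le> B"
    unfolding bounded_iff by blast
  then have "\<forall>z. B + 1 \<le> norm z \<longrightarrow> poly q z \<noteq> 0"
    by fastforce
  then show ?thesis
    unfolding eventually_at_infinity by blast
qed

lemma rf_has_value_at_infinity_add:
  assumes "rf_has_value_at_infinity r v" "rf_has_value_at_infinity s w"
  shows "rf_has_value_at_infinity (r + s) (v + w)"
proof -
  obtain p q where 1: "r = Fraction_Field.Fract p q" "q \<noteq> 0"
    "((\<lambda>z. poly p z / poly q z) \<longlongrightarrow> v) at_infinity"
    using assms(1) unfolding rf_has_value_at_infinity_def by blast
  obtain p' q' where 2: "s = Fraction_Field.Fract p' q'" "q' \<noteq> 0"
    "((\<lambda>z. poly p' z / poly q' z) \<longlongrightarrow> w) at_infinity"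
    using assms(2) unfolding rf_has_value_at_infinity_def by blast
  have "eventually (\<lambda>z. poly p z / poly q z + poly p' z / poly q' z
      = poly (p * q' + p' * q) z / poly (q * q') z) at_infinity"
    using eventually_poly_nonzero_at_infinity[OF 1(2)] eventually_poly_nonzero_at_infinity[OF 2(2)]
    by eventually_elim (simp add: add_frac_eq)
  then have "((\<lambda>z. poly (p * q' + p' * q) z / poly (q * q') z) \<longlongrightarrow> v + w) at_infinity"
    by (rule Lim_transform_eventually[OF tendsto_add[OF 1(3) 2(3)]])
  moreover have "r + s = Fraction_Field.Fract (p * q' + p' * q) (q * q')" "q * q' \<noteq> 0"
    using 1 2 by simp_all
  ultimately show ?thesis unfolding rf_has_value_at_infinity_def by blast
qed

lemma rf_has_value_at_infinity_mult:
  assumes "rf_has_value_at_infinity r v" "rf_has_value_at_infinity s w"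
  shows "rf_has_value_at_infinity (r * s) (v * w)"
proof -
  obtain p q where 1: "r = Fraction_Field.Fract p q" "q \<noteq> 0"
    "((\<lambda>z. poly p z / poly q z) \<longlongrightarrow> v) at_infinity"
    using assms(1) unfolding rf_has_value_at_infinity_def by blast
  obtain p' q' where 2: "s = Fraction_Field.Fract p' q'" "q' \<noteq> 0"
    "((\<lambda>z. poly p' z / poly q' z) \<longlongrightarrow> w) at_infinity"
    using assms(2) unfolding rf_has_value_at_infinity_def by blast
  \<comment> \<open>Quotients multiply pointwise even where a denominator vanishes, since both sides
    are then 0.\<close>
  have "((\<lambda>z. poly (p * p') z / poly (q * q') z) \<longlongrightarrow> v * w) at_infinity"
    using tendsto_mult[OF 1(3) 2(3)] by simp
  moreover have "r * s = Fraction_Field.Fract (p * p') (q * q')" "q * q' \<noteq> 0"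
    using 1 2 by simp_all
  ultimately show ?thesis unfolding rf_has_value_at_infinity_def by blast
qed

lemma rf_has_value_at_infinity_const: "rf_has_value_at_infinity (rf_const c) c"
  unfolding rf_has_value_at_infinity_def rf_const_def
  by (rule exI[of _ "[:c:]"], rule exI[of _ 1]) simp

lemma rf_has_value_at_infinity_sum:
  assumes "\<And>k. k \<in> A \<Longrightarrow> rf_has_value_at_infinity (f k) (v k)"
  shows "rf_has_value_at_infinity (sum f A) (sum v A)"
  using assms
  by (induction A rule: infinite_finite_induct)
    (auto simp: rf_has_value_at_infinity_add rf_has_value_at_infinity_const[of 0, unfolded rf_const_0])

lemma rf_has_value_at_infinity_matrix_mult:
  assumes "\<And>i j. rf_has_value_at_infinity (g $ i $ j) (A $ i $ j)"
    and "\<And>i j. rf_has_value_at_infinity (h $ i $ j) (B $ i $ j)"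
  shows "rf_has_value_at_infinity ((g ** h) $ i $ j) ((A ** B) $ i $ j)"
  by (simp add: matrix_matrix_mult_def rf_has_value_at_infinity_sum rf_has_value_at_infinity_mult
      assms)

subsection \<open>Simple factors and their products\<close>

lemma rf_var_minus_const: "rf_var - rf_const \<gamma> = Fraction_Field.Fract [:- \<gamma>, 1:] 1"
  by (simp add: rf_var_def rf_const_def)

lemma rf_has_value_at_infinity_mat_1: "rf_has_value_at_infinity (mat 1 $ i $ j) (mat 1 $ i $ j)"
  using rf_has_value_at_infinity_const[of 0] rf_has_value_at_infinity_const[of 1]
  by (simp add: mat_def rf_const_0 rf_const_1)

lemma m_simple_at_infinity:
  "rf_has_value_at_infinity (m_simple \<gamma> P $ i $ j) (mat 1 $ i $ j)"
proof -
  have "((\<lambda>z. inverse (z - \<gamma>)) \<longlongrightarrow> 0) at_infinity"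
    using filterlim_compose[OF tendsto_inverse_0
        tendsto_add_filterlim_at_infinity[OF tendsto_const[of "- \<gamma>"] filterlim_ident]]
    by simp
  then have "rf_has_value_at_infinity (1 / (rf_var - rf_const \<gamma>)) 0"
    unfolding rf_has_value_at_infinity_def rf_var_minus_const
    by - (rule exI[of _ 1], rule exI[of _ "[:- \<gamma>, 1:]"],
        simp add: Fraction_Field.One_fract_def divide_inverse)
  then have "rf_has_value_at_infinity (1 / (rf_var - rf_const \<gamma>) * rf_const (P $ i $ j)) 0"
    by (metis rf_has_value_at_infinity_mult rf_has_value_at_infinity_const mult_zero_left)
  from rf_has_value_at_infinity_add[OF rf_has_value_at_infinity_mat_1 this]
  show ?thesis
    by (simp add: m_simple_def)
qed

lemma rf_has_value_m_simple:
  assumes "z \<noteq> \<gamma>"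
  shows "rf_has_value (m_simple \<gamma> P $ i $ j) z ((mat 1 + scale_matrix (1 / (z - \<gamma>)) P) $ i $ j)"
proof -
  have "rf_has_value (1 / (rf_var - rf_const \<gamma>)) z (1 / (z - \<gamma>))"
    unfolding rf_has_value_def rf_var_minus_const using assms
    by - (rule exI[of _ 1], rule exI[of _ "[:- \<gamma>, 1:]"], simp add: Fraction_Field.One_fract_def)
  from rf_has_value_add[OF rf_has_value_mat_1 rf_has_value_mult[OF this rf_has_value_const]]
  show ?thesis
    by (simp add: m_simple_def)
qed

section \<open>Residues at simple poles\<close>

lemma rf_has_value_var_minus_const: "rf_has_value (rf_var - rf_const \<gamma>) z (z - \<gamma>)"
  unfolding rf_has_value_def rf_var_minus_const
  by (rule exI[of _ "[:- \<gamma>, 1:]"], rule exI[of _ 1]) simp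

text \<open>The residue is expressed as the value at \<gamma> of the map multiplied by \<lambda> -
  \<gamma>, in which the pole has cancelled.\<close>

lemma m_simple_residue:
  "rf_has_value (scale_matrix (rf_var - rf_const \<gamma>) (m_simple \<gamma> P) $ i $ j) \<gamma> (P $ i $ j)"
proof -
  have "rf_var - rf_const \<gamma> \<noteq> 0"
    by (simp add: rf_var_minus_const Fraction_Field.Zero_fract_def Fraction_Field.eq_fract)
  then have "scale_matrix (rf_var - rf_const \<gamma>) (m_simple \<gamma> P) $ i $ j
      = (rf_var - rf_const \<gamma>) * mat 1 $ i $ j + rf_const (P $ i $ j)"
    by (simp add: m_simple_def distrib_left)
  moreover have "rf_has_value ((rf_var - rf_const \<gamma>) * mat 1 $ i $ j + rf_const (P $ i $ j)) \<gamma>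
      ((\<gamma> - \<gamma>) * mat 1 $ i $ j + P $ i $ j)"
    by (intro rf_has_value_add rf_has_value_mult rf_has_value_var_minus_const rf_has_value_mat_1
        rf_has_value_const)
  ultimately show ?thesis
    by simp
qed

text \<open>If g is regular at \<gamma>, then (\<lambda> - \<gamma>) g vanishes there, and values
  are unique. A nonzero residue therefore excludes a regular value.\<close>

lemma residue_eq_0:
  assumes "takes_GL_value g \<gamma> A"
    and "\<And>i j. rf_has_value (scale_matrix (rf_var - rf_const \<gamma>) g $ i $ j) \<gamma> (R $ i $ j)"
  shows "R = 0"
proof -
  have "rf_has_value ((rf_var - rf_const \<gamma>) * g $ i $ j) \<gamma> ((\<gamma> - \<gamma>) * A $ i $ j)" for i j
    using assms(1) by (intro rf_has_value_mult rf_has_value_var_minus_const)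
      (simp add: takes_GL_value_def)
  then have "R $ i $ j = 0" for i j
    using rf_has_value_unique[OF assms(2)] by simp
  then show ?thesis
    by (simp add: vec_eq_iff)
qed

lemma s_elem_at_infinity:
  "rf_has_value_at_infinity (s_elem \<alpha> N $ i $ j) (mat 1 $ i $ j)"
  unfolding s_elem_def
  by (rule rf_has_value_at_infinity_matrix_mult[OF m_simple_at_infinity m_simple_at_infinity,
        unfolded matrix_mul_lid])

lemma m_simple_0: "m_simple \<gamma> 0 = mat 1"
  by (simp add: m_simple_def vec_eq_iff rf_const_0)

text \<open>This is the degenerate case N = 0, where \<plusminus>\<alpha> are not poles.\<close>

lemma mat_1_in_L_minus_tau_sigma: "(mat 1 :: rat_fun^'n^'n) \<in> L_minus_tau_sigma"
proof -
  let ?I = "mat 1 :: rat_fun^'n^'n"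
  have "takes_GL_value ?I z A \<longleftrightarrow> A = mat 1" for z and A :: "complex^'n^'n"
    using takes_GL_value_mat_1 takes_GL_value_unique by blast
  moreover have "tau_GL (mat 1) = (mat 1 :: complex^'n^'n)"
    by (simp add: tau_GL_def map_matrix_cnj_mat_1)
  moreover have "sigma_GL (mat 1) = (mat 1 :: complex^'n^'n)"
    by (simp add: sigma_GL_def matrix_inv_eqI)
  ultimately show ?thesis
    by (simp add: L_minus_tau_sigma_def rf_has_value_at_infinity_mat_1)
qed

text \<open>Passes from N and N' to the normalised n and n', whose coefficients satisfy x y = x -
  y.\<close>

lemma scale_matrix_rescale:
  fixes P :: "complex^'n^'n"
  assumes "\<alpha> \<noteq> 0"
  shows "scale_matrix (1 / w) P
    = scale_matrix (2 * complex_of_real \<alpha> / w) ((1 / (2 * \<alpha>)) *\<^sub>R P)"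
proof -
  have "1 / w * p = 2 * complex_of_real \<alpha> / w * ((1 / (2 * \<alpha>)) *\<^sub>R p)" for p
    using assms by (simp add: scaleR_conv_of_real)
  then show ?thesis
    unfolding vec_eq_iff scale_matrix_nth vector_scaleR_component by blast
qed

section \<open>Membership of \<open>s_elem\<close> in the twisted loop group\<close>

theorem corollary5p5:
  fixes \<alpha> :: real and N :: "complex ^'n^'n"
  assumes "N ** N = 0"
    and "map_matrix cnj N = N"
    and "\<alpha> \<noteq> 0"
    and "invertible (mat 1 + (1 / (4 * \<alpha>\<^sup>2)) *\<^sub>R (transpose N ** N))"
  shows "s_elem \<alpha> N \<in> L_minus_tau_sigma"
proof -
  define c where "c = complex_of_real \<alpha>"
  define n where "n = (1 / (2 * \<alpha>)) *\<^sub>R N"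
  define m where "m = transpose n"
  define K where "K = matrix_inv (mat 1 + m ** n)"
  define N' where "N' = N_prime \<alpha> N"
  define n' where "n' = (1 / (2 * \<alpha>)) *\<^sub>R N'"
  define S where "S z = (mat 1 + scale_matrix (2 * c / (z + c)) n')
      ** (mat 1 + scale_matrix (2 * c / (z - c)) n)" for z

  have mn: "m ** n = (1 / (4 * \<alpha>\<^sup>2)) *\<^sub>R (transpose N ** N)"
    by (simp add: m_def n_def transpose_scalar scalar_matrix_assoc[symmetric]
        matrix_scalar_ac power2_eq_square)
  have inv: "invertible (mat 1 + m ** n)"
    using assms(4) mn by simp
  have nn: "n ** n = 0"
    using assms(1) by (simp add: n_def scalar_matrix_assoc[symmetric] matrix_scalar_ac)
  then have mm: "m ** m = 0"
    unfolding m_def by (metis matrix_transpose_mul transpose_mat mat_0)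
  have Kr: "(mat 1 + m ** n) ** K = mat 1"
    unfolding K_def by (rule matrix_inv_right[OF inv])
  then have Kl: "K ** (mat 1 + m ** n) = mat 1"
    using matrix_left_right_inverse by blast
  \<comment> \<open>The factor 1 / (2 \<alpha>) of n' is absorbed by N^t, which becomes m.\<close>
  have n': "n' = (mat 1 - n) ** K ** m ** (mat 1 + n)"
    unfolding n'_def N'_def N_prime_def K_def mn
    unfolding m_def n_def
    by (simp add: transpose_scalar scalar_matrix_assoc[symmetric] matrix_scalar_ac)
  \<comment> \<open>The symmetry of 1 + n^t n passes to its inverse K and gives n'^t the form
    required by \<open>dressed_nilpotent_identity\<close>.\<close>
  have "transpose (mat 1 + m ** n) = mat 1 + m ** n"
    by (simp add: transpose_add matrix_transpose_mul m_def)
  then have "transpose K = K"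
    using transpose_matrix_inv[OF inv] by (simp add: K_def)
  then have "transpose n' = (mat 1 + m) ** n ** K ** (mat 1 - m)"
    by (simp add: n' matrix_transpose_mul transpose_add transpose_diff m_def matrix_mul_assoc)
  then have id: "(mat 1 + transpose n') ** n' = transpose n ** (mat 1 + n)"
    using dressed_nilpotent_identity[OF nn mm Kl Kr] by (simp add: n' m_def)
  have n'n': "n' ** n' = 0"
    unfolding n' by (rule dressed_nilpotent_square[OF nn mm Kl Kr])

  have N'N': "N' ** N' = 0"
    using n'n' assms(3) by (simp add: n'_def scalar_matrix_assoc[symmetric] matrix_scalar_ac)

  have cnj_n: "map_matrix cnj n = n"
    by (simp add: n_def map_matrix_cnj assms(2))
  then have cnj_m: "map_matrix cnj m = m"
    by (simp add: m_def map_matrix_cnj)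
  have cnj_n': "map_matrix cnj n' = n'"
    by (simp add: n' K_def map_matrix_cnj inv cnj_n cnj_m)

  have S: "takes_GL_value (s_elem \<alpha> N) z (S z)" if "z \<noteq> c" "z \<noteq> - c" for z
  proof -
    have "takes_GL_value (m_simple (- c) N') z (mat 1 + scale_matrix (2 * c / (z + c)) n')"
      using rf_has_value_m_simple[OF that(2), of N'] n'n'
      by (simp add: takes_GL_value_def invertible_mat_1_add_nilpotent
          scale_matrix_rescale[OF assms(3)] n'_def c_def)
    moreover have "takes_GL_value (m_simple c N) z (mat 1 + scale_matrix (2 * c / (z - c)) n)"
      using rf_has_value_m_simple[OF that(1), of N] nn
      by (simp add: takes_GL_value_def invertible_mat_1_add_nilpotent
          scale_matrix_rescale[OF assms(3)] n_def c_def)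
    ultimately show ?thesis
      unfolding s_elem_def S_def c_def[symmetric] N'_def[symmetric] by (rule takes_GL_value_mult)
  qed

  \<comment> \<open>The matrices n and n' and the scalar c are all real.\<close>
  have S_cnj: "S (cnj z) = map_matrix cnj (S z)" for z
  proof -
    have "map_matrix cnj (scale_matrix w A) = scale_matrix (cnj w) (map_matrix cnj A)"
      for w and A :: "complex^'n^'n"
      by (simp add: vec_eq_iff)
    then show ?thesis
      by (simp add: S_def map_matrix_cnj cnj_n cnj_n' c_def)
  qed

  have S_twisted: "sigma_GL (S (- z)) = S z" if "z \<noteq> c" "z \<noteq> - c" for z
  proof -
    define x y where "x = 2 * c / (z - c)" and "y = 2 * c / (z + c)"
    have nz: "z - c \<noteq> 0" "z + c \<noteq> 0"
      using that by (auto simp: eq_neg_iff_add_eq_0)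
    then have xy: "x * y = x - y"
      by (simp add: x_def y_def field_simps)
    have "2 * c / (- z + c) = - x" "2 * c / (- z - c) = - y"
      using nz unfolding x_def y_def by (metis minus_diff_eq minus_divide_right uminus_add_conv_diff
          add.commute minus_add_distrib)+
    moreover have "scale_matrix (- w) A = - scale_matrix w A" for w and A :: "complex^'n^'n"
      by (simp add: vec_eq_iff)
    ultimately have "S (- z) = (mat 1 - scale_matrix x n') ** (mat 1 - scale_matrix y n)"
      by (simp add: S_def)
    moreover have "S z = (mat 1 + scale_matrix y n') ** (mat 1 + scale_matrix x n)"
      by (simp add: S_def x_def y_def)
    ultimately have "transpose (S (- z)) ** S z = mat 1"
      using dressed_factor_twisted[OF nn id xy] by simp
    then show ?thesis
      unfolding sigma_GL_def by (rule matrix_inv_eqI)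
  qed

  \<comment> \<open>If both points are excluded, the invertible values are exactly those of
    \<open>S\<close> off {c, -c}. This set is stable under conjugation and negation, so the
    properties of \<open>S\<close> suffice.\<close>
  have member: "s_elem \<alpha> N \<in> L_minus_tau_sigma"
    if poles: "\<And>A. \<not> takes_GL_value (s_elem \<alpha> N) c A" "\<And>A. \<not> takes_GL_value (s_elem \<alpha> N) (- c) A"
  proof -
    have regular: "z \<noteq> c \<and> z \<noteq> - c \<and> A = S z" if "takes_GL_value (s_elem \<alpha> N) z A" for z A
      using that poles S takes_GL_value_unique by metis
    have "finite {z. \<not> (\<exists>A. takes_GL_value (s_elem \<alpha> N) z A)}"
      by (rule finite_subset[of _ "{c, - c}"]) (use S in auto)
    moreover have "takes_GL_value (s_elem \<alpha> N) (cnj z) (tau_GL A)"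
      if "takes_GL_value (s_elem \<alpha> N) z A" for z A
    proof -
      have "cnj z \<noteq> c" "cnj z \<noteq> - c"
        using regular[OF that] by (auto simp: c_def complex_eq_iff)
      then show ?thesis
        using S regular[OF that] S_cnj unfolding tau_GL_def by metis
    qed
    moreover have "takes_GL_value (s_elem \<alpha> N) z (sigma_GL A)"
      if "takes_GL_value (s_elem \<alpha> N) (- z) A" for z A
    proof -
      have "z \<noteq> c" "z \<noteq> - c"
        using regular[OF that] by auto
      then show ?thesis
        using S S_twisted regular[OF that] by metis
    qed
    ultimately show ?thesis
      unfolding L_minus_tau_sigma_def using s_elem_at_infinity by blast
  qed

  show ?thesis
  proof (cases "N = 0")
    case True
    then have "N' = 0"
      by (simp add: N'_def N_prime_def transpose_def zero_vec_def[symmetric])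
    with True have "s_elem \<alpha> N = mat 1"
      by (simp add: s_elem_def N'_def m_simple_0)
    then show ?thesis
      by (simp add: mat_1_in_L_minus_tau_sigma)
  next
    case False
    show ?thesis
    proof (rule member)
      fix A
      show "\<not> takes_GL_value (s_elem \<alpha> N) c A"
      proof
        assume A: "takes_GL_value (s_elem \<alpha> N) c A"
        \<comment> \<open>The coefficient of N' in the left factor at \<lambda> = c. That factor is
          invertible, so a vanishing residue at c forces N = 0.\<close>
        define w where "w = 1 / (c - - c)"
        have "c \<noteq> - c"
          using assms(3) by (simp add: c_def)
        then have "rf_has_value (scale_matrix (rf_var - rf_const c) (s_elem \<alpha> N) $ i $ j) c
            (((mat 1 + scale_matrix w N') ** N) $ i $ j)" for i j
          unfolding s_elem_def scale_matrix_mult_right[symmetric] c_def[symmetric]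
            N'_def[symmetric] w_def
          by (intro rf_has_value_matrix_mult rf_has_value_m_simple m_simple_residue)
        then have "(mat 1 + scale_matrix w N') ** N = 0"
          by (rule residue_eq_0[OF A])
        moreover have "(mat 1 - scale_matrix w N') ** (mat 1 + scale_matrix w N') = mat 1"
          by (rule add_mult_diff_nilpotent(2)[OF N'N'])
        ultimately show False
          using False by (metis matrix_mul_assoc matrix_mul_lid times0_right)
      qed
      show "\<not> takes_GL_value (s_elem \<alpha> N) (- c) A"
      proof
        assume A: "takes_GL_value (s_elem \<alpha> N) (- c) A"
        \<comment> \<open>The coefficient of N in the right factor at \<lambda> = -c; cancelling
          that factor from the vanishing residue gives N' = 0.\<close>
        define w where "w = 1 / (- c - c)"
        have "- c \<noteq> c"
          using assms(3) by (simp add: c_def)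
        then have "rf_has_value (scale_matrix (rf_var - rf_const (- c)) (s_elem \<alpha> N) $ i $ j) (- c)
            ((N' ** (mat 1 + scale_matrix w N)) $ i $ j)" for i j
          unfolding s_elem_def scale_matrix_mult_left[symmetric] c_def[symmetric]
            N'_def[symmetric] w_def
          by (intro rf_has_value_matrix_mult rf_has_value_m_simple m_simple_residue)
        then have "N' ** (mat 1 + scale_matrix w N) = 0"
          by (rule residue_eq_0[OF A])
        moreover have "(mat 1 + scale_matrix w N) ** (mat 1 - scale_matrix w N) = mat 1"
          by (rule add_mult_diff_nilpotent(1)[OF assms(1)])
        ultimately have "N' = 0"
          by (metis matrix_mul_assoc matrix_mul_rid times0_left)
        \<comment> \<open>With n' = 0 only the right-hand side of \<open>id\<close> remains; as 1 +
          n is invertible, m vanishes, and with it n and N.\<close>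
        then have "m ** (mat 1 + n) = 0"
          using id by (simp add: n'_def m_def)
        moreover have "(mat 1 + n) ** (mat 1 - n) = mat 1"
          by (simp add: matrix_distribs nn)
        ultimately have "m = 0"
          by (metis matrix_mul_assoc matrix_mul_rid times0_left)
        then have "n = 0"
          unfolding m_def by (metis transpose_mat mat_0 transpose_transpose)
        then show False
          using False assms(3) by (simp add: n_def)
      qed
    qed
  qed
qed

end
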